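(* Let $\mathcal X=\{1,\dots,J\}$ be a finite set, with all subsets measurable and $\mu(X)=\#X/J$ for $X\subset\mathcal X$, so that $\mathcal H=L^2(\mathcal X,\mu)\cong\mathbb C^J$. Let $W=(W_{jk})_{j,k=1}^J$ be a linear operator on $\mathcal H$, identified with its $J\times J$ matrix. Then $$\|W\|_\mu^2=\frac1J\sum_{j,k=1}^J|W_{kj}|^2,$$ and $\|W\|_\mu=\|WU\|_\mu$ for every unitary operator $U$ on $\mathcal H$.
   Context: For a probability space $(\mathcal X,\mathcal B,\mu)$ and $\mathcal H=L^2(\mathcal X,\mu)$ (complex-valued; in the finite case $\langle f,g\rangle=\frac1J\sum_j f_j\overline{g_j}$), $\pi_X:\mathcal H\to\mathcal H$ denotes the orthogonal projector $\pi_Xf=\mathbf 1_X f$ for $X\in\mathcal B$. A partition is a finite family $\chi=\{Y_1,\dots,Y_n\}\subset\mathcal B$ with $\mu(\mathcal X\setminus\bigcup_j Y_j)=0$ and $\mu(Y_j\cap Y_k)=0$ for $j\ne k$. For a bounded operator $W$ on $\mathcal H$ with operator norm $\|W\|$, put $\mathcal M_\chi(W)=\sum_{j}\mu(Y_j)\|W\pi_{Y_j}\|^2$, and define the $\mu$-norm $\|W\|_\mu=\inf_\chi\sqrt{\mathcal M_\chi(W)}$, the infimum being over all partitions $\chi$. The matrix acts by $(Wf)_j=\sum_k W_{jk}f_k$. *)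

theory Defs
  imports "HOL-Analysis.Analysis"
begin

text \<open>
  The library has no type of \<open>L\<^sup>2\<close> spaces over a measure space. Elements of \<open>L\<^sup>2(M)\<close> are
  represented here by square-integrable functions, and equality in \<open>L\<^sup>2(M)\<close> by equality almost
  everywhere. Operators are maps on representatives. If the only null set is the empty set (as for
  the uniform measure on a finite set), the representation is one-to-one.
\<close>

definition L2_space :: "'a measure \<Rightarrow> ('a \<Rightarrow> complex) set" where
  "L2_space M = {f \<in> borel_measurable M. integrable M (\<lambda>x. (cmod (f x))\<^sup>2)}"

definition L2_inner :: "'a measure \<Rightarrow> ('a \<Rightarrow> complex) \<Rightarrow> ('a \<Rightarrow> complex) \<Rightarrow> complex" where
  "L2_inner M f g = (\<integral>x. f x * cnj (g x) \<partial>M)"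

definition L2_norm :: "'a measure \<Rightarrow> ('a \<Rightarrow> complex) \<Rightarrow> real" where
  "L2_norm M f = sqrt (\<integral>x. (cmod (f x))\<^sup>2 \<partial>M)"

text \<open>Meaningful for bounded operators only: the supremum of an unbounded set is unspecified.\<close>

definition L2_opnorm :: "'a measure \<Rightarrow> (('a \<Rightarrow> complex) \<Rightarrow> ('a \<Rightarrow> complex)) \<Rightarrow> real" where
  "L2_opnorm M W = (SUP f\<in>{f \<in> L2_space M. L2_norm M f \<le> 1}. L2_norm M (W f))"

definition L2_linear :: "'a measure \<Rightarrow> (('a \<Rightarrow> complex) \<Rightarrow> ('a \<Rightarrow> complex)) \<Rightarrow> bool" where
  "L2_linear M W \<longleftrightarrow>
     (\<forall>f\<in>L2_space M. W f \<in> L2_space M) \<and>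
     (\<forall>f\<in>L2_space M. \<forall>g\<in>L2_space M. AE x in M. W (\<lambda>y. f y + g y) x = W f x + W g x) \<and>
     (\<forall>c. \<forall>f\<in>L2_space M. AE x in M. W (\<lambda>y. c * f y) x = c * W f x)"

text \<open>
  A unitary operator is a surjective linear map preserving the inner product. Compatibility with
  equality almost everywhere follows from linearity and isometry.
\<close>

definition L2_unitary :: "'a measure \<Rightarrow> (('a \<Rightarrow> complex) \<Rightarrow> ('a \<Rightarrow> complex)) \<Rightarrow> bool" where
  "L2_unitary M U \<longleftrightarrow>
     L2_linear M U \<and>
     (\<forall>f\<in>L2_space M. \<forall>g\<in>L2_space M. L2_inner M (U f) (U g) = L2_inner M f g) \<and>
     (\<forall>g\<in>L2_space M. \<exists>f\<in>L2_space M. AE x in M. U f x = g x)"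

definition proj_op :: "'a set \<Rightarrow> ('a \<Rightarrow> complex) \<Rightarrow> ('a \<Rightarrow> complex)" where
  "proj_op X f = (\<lambda>x. indicator X x * f x)"

text \<open>The partition \<open>{Y\<^sub>1, \<dots>, Y\<^sub>n}\<close> is given by its length \<open>n\<close> and the indexed family \<open>Y\<close>.\<close>

definition mu_partition :: "'a measure \<Rightarrow> nat \<Rightarrow> (nat \<Rightarrow> 'a set) \<Rightarrow> bool" where
  "mu_partition M n Y \<longleftrightarrow>
     (\<forall>j\<in>{1..n}. Y j \<in> sets M) \<and>
     measure M (space M - (\<Union>j\<in>{1..n}. Y j)) = 0 \<and>
     (\<forall>j\<in>{1..n}. \<forall>k\<in>{1..n}. j \<noteq> k \<longrightarrow> measure M (Y j \<inter> Y k) = 0)"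

definition partition_sum ::
  "'a measure \<Rightarrow> nat \<Rightarrow> (nat \<Rightarrow> 'a set) \<Rightarrow> (('a \<Rightarrow> complex) \<Rightarrow> ('a \<Rightarrow> complex)) \<Rightarrow> real" where
  "partition_sum M n Y W = (\<Sum>j=1..n. measure M (Y j) * (L2_opnorm M (W \<circ> proj_op (Y j)))\<^sup>2)"

definition mu_norm :: "'a measure \<Rightarrow> (('a \<Rightarrow> complex) \<Rightarrow> ('a \<Rightarrow> complex)) \<Rightarrow> real" where
  "mu_norm M W = Inf {sqrt (partition_sum M n Y W) | n Y. mu_partition M n Y}"

definition matrix_op :: "complex ^ 'n ^ 'n \<Rightarrow> ('n::finite \<Rightarrow> complex) \<Rightarrow> ('n \<Rightarrow> complex)" where
  "matrix_op W f = (\<lambda>j. \<Sum>k\<in>UNIV. W $ j $ k * f k)"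

end

theory Submission
  imports Defs
begin

text \<open>
  By Cauchy--Schwarz, \<open>\<parallel>W \<pi>\<^sub>Y\<parallel>\<^sup>2\<close> is at most the sum of the squared Euclidean lengths of the columns of
  \<open>W\<close> indexed by \<open>Y\<close>, and it is at least each one of them. Since \<open>\<mu>(Y) = #Y/J\<close>, every partition sum is
  bounded below by the normalised squared Frobenius norm of \<open>W\<close>, and the partition into singletons
  attains this bound. A unitary \<open>U\<close> is given by a matrix \<open>V\<close> with \<open>V V\<^sup>* = 1\<close>, and the squared
  Frobenius norm is \<open>tr (W W\<^sup>*)\<close>, which does not change when \<open>W\<close> is replaced by \<open>W V\<close>.
\<close>

lemma L2_space_uniform_count: "L2_space (uniform_count_measure (UNIV :: 'n::finite set)) = UNIV"
proof -
  have "f \<in> borel_measurable (uniform_count_measure UNIV)" for f :: "'n \<Rightarrow> 'b::topological_space"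
    by (simp add: measurable_def)
  then show ?thesis
    by (auto simp: L2_space_def uniform_count_measure_def integrable_point_measure_finite)
qed

text \<open>Each point has mass \<open>1 / J\<close> with \<open>J = CARD('n)\<close>, so only the
  empty set is null. All a.e. statements about operators thus become pointwise ones.\<close>

lemma AE_uniform_count_iff:
  "(AE x in uniform_count_measure (UNIV :: 'n::finite set). P x) \<longleftrightarrow> (\<forall>x. P x)"
  unfolding uniform_count_measure_def AE_point_measure by simp

lemma L2_inner_uniform_count:
  "L2_inner (uniform_count_measure (UNIV :: 'n::finite set)) f g = (\<Sum>i\<in>UNIV. f i * cnj (g i)) / CARD('n)"
  by (simp add: L2_inner_def uniform_count_measure_def lebesgue_integral_point_measure_finite
      sum_divide_distrib scaleR_conv_of_real)

lemma L2_norm_uniform_count: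
  "L2_norm (uniform_count_measure (UNIV :: 'n::finite set)) f = sqrt ((\<Sum>i\<in>UNIV. (cmod (f i))\<^sup>2) / CARD('n))"
  by (simp add: L2_norm_def uniform_count_measure_def lebesgue_integral_point_measure_finite
      sum_divide_distrib)

lemma L2_norm_matrix_proj_le:
  fixes W :: "complex ^ 'n ^ 'n"
  assumes "L2_norm (uniform_count_measure UNIV) f \<le> 1"
  shows "L2_norm (uniform_count_measure UNIV) ((matrix_op W \<circ> proj_op Y) f)
           \<le> sqrt (\<Sum>k\<in>Y. \<Sum>j\<in>UNIV. (cmod (W $ j $ k))\<^sup>2)"
proof -
  \<comment> \<open>In the normalised norm the unit ball has Euclidean radius \<open>sqrt J\<close>.
    The factor \<open>J\<close> gained here cancels the \<open>1 / J\<close> in the norm of the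
    image.\<close>
  have f: "(\<Sum>i\<in>UNIV. (cmod (f i))\<^sup>2) \<le> CARD('n)"
    using assms by (simp add: L2_norm_uniform_count)
  have "(cmod ((matrix_op W \<circ> proj_op Y) f j))\<^sup>2 \<le> (\<Sum>k\<in>Y. (cmod (W $ j $ k))\<^sup>2) * CARD('n)" for j
  proof -
    have "(matrix_op W \<circ> proj_op Y) f j = (\<Sum>k\<in>Y. W $ j $ k * f k)"
      by (auto simp: matrix_op_def proj_op_def indicator_def intro!: sum.mono_neutral_cong_right)
    then have "cmod ((matrix_op W \<circ> proj_op Y) f j) \<le> (\<Sum>k\<in>Y. cmod (W $ j $ k) * cmod (f k))"
      by (simp add: norm_mult sum_norm_le)
    then have "(cmod ((matrix_op W \<circ> proj_op Y) f j))\<^sup>2 \<le> (\<Sum>k\<in>Y. cmod (W $ j $ k) * cmod (f k))\<^sup>2"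
      by (intro power_mono) auto
    also have "\<dots> \<le> (\<Sum>k\<in>Y. (cmod (W $ j $ k))\<^sup>2) * (\<Sum>k\<in>Y. (cmod (f k))\<^sup>2)"
      by (rule Cauchy_Schwarz_ineq_sum)
    also have "\<dots> \<le> (\<Sum>k\<in>Y. (cmod (W $ j $ k))\<^sup>2) * CARD('n)"
      by (intro mult_left_mono order_trans[OF sum_mono2 f] sum_nonneg) auto
    finally show ?thesis .
  qed
  then have "(\<Sum>j\<in>UNIV. (cmod ((matrix_op W \<circ> proj_op Y) f j))\<^sup>2)
      \<le> (\<Sum>j\<in>UNIV. (\<Sum>k\<in>Y. (cmod (W $ j $ k))\<^sup>2) * CARD('n))"
    by (intro sum_mono)
  also have "\<dots> = (\<Sum>k\<in>Y. \<Sum>j\<in>UNIV. (cmod (W $ j $ k))\<^sup>2) * CARD('n)"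
    by (subst sum.swap) (simp add: sum_distrib_right)
  finally show ?thesis
    by (simp add: L2_norm_uniform_count divide_le_eq)
qed

lemma L2_opnorm_matrix_proj_le:
  fixes W :: "complex ^ 'n ^ 'n"
  shows "L2_opnorm (uniform_count_measure UNIV) (matrix_op W \<circ> proj_op Y)
           \<le> sqrt (\<Sum>k\<in>Y. \<Sum>j\<in>UNIV. (cmod (W $ j $ k))\<^sup>2)"
proof -
  \<comment> \<open>The zero function shows that the supremum is taken over a nonempty set.\<close>
  have "L2_norm (uniform_count_measure (UNIV :: 'n set)) (\<lambda>_. 0) \<le> 1"
    by (simp add: L2_norm_uniform_count)
  then show ?thesis
    unfolding L2_opnorm_def L2_space_uniform_count
    by (intro cSUP_least L2_norm_matrix_proj_le) auto
qed

text \<open>Test the operator on \<open>sqrt J\<close> times the \<open>k\<close>-th unit vector, which has \<open>L\<^sup>2\<close> norm 1.\<close>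

lemma L2_opnorm_matrix_proj_ge:
  fixes W :: "complex ^ 'n ^ 'n"
  assumes "k \<in> Y"
  shows "sqrt (\<Sum>j\<in>UNIV. (cmod (W $ j $ k))\<^sup>2)
           \<le> L2_opnorm (uniform_count_measure UNIV) (matrix_op W \<circ> proj_op Y)"
proof -
  let ?M = "uniform_count_measure (UNIV :: 'n set)"
  define e :: "'n \<Rightarrow> complex" where "e = (\<lambda>i. if i = k then sqrt CARD('n) else 0)"
  have "(\<Sum>i\<in>UNIV. (cmod (e i))\<^sup>2) = (\<Sum>i\<in>UNIV. if i = k then real CARD('n) else 0)"
    by (intro sum.cong) (auto simp: e_def)
  then have e: "L2_norm ?M e \<le> 1"
    by (simp add: L2_norm_uniform_count)
  \<comment> \<open>Since \<open>k \<in> Y\<close>, the projector fixes \<open>e\<close>, and the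
    image is \<open>sqrt J\<close> times column \<open>k\<close>.\<close>
  have "matrix_op W (proj_op Y e) j = (\<Sum>i\<in>UNIV. if i = k then W $ j $ k * sqrt CARD('n) else 0)" for j
    unfolding matrix_op_def using assms by (intro sum.cong) (auto simp: proj_op_def e_def)
  then have "L2_norm ?M ((matrix_op W \<circ> proj_op Y) e) = sqrt (\<Sum>j\<in>UNIV. (cmod (W $ j $ k))\<^sup>2)"
    by (simp add: L2_norm_uniform_count norm_mult power_mult_distrib flip: sum_distrib_right)
  \<comment> \<open>The supremum is an upper bound because the Cauchy--Schwarz estimate bounds the
    set of values.\<close>
  moreover have "L2_norm ?M ((matrix_op W \<circ> proj_op Y) e) \<le> L2_opnorm ?M (matrix_op W \<circ> proj_op Y)"
    unfolding L2_opnorm_def L2_space_uniform_count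
    using e L2_norm_matrix_proj_le by (intro cSUP_upper bdd_aboveI2) auto
  ultimately show ?thesis by simp
qed

lemma L2_opnorm_matrix_proj_singleton:
  fixes W :: "complex ^ 'n ^ 'n"
  shows "L2_opnorm (uniform_count_measure UNIV) (matrix_op W \<circ> proj_op {k})
           = sqrt (\<Sum>j\<in>UNIV. (cmod (W $ j $ k))\<^sup>2)"
  using L2_opnorm_matrix_proj_le[of W "{k}"] L2_opnorm_matrix_proj_ge[of k "{k}" W] by simp

lemma partition_sum_matrix_ge:
  fixes W :: "complex ^ 'n ^ 'n"
  assumes "mu_partition (uniform_count_measure UNIV) n Y"
  shows "(\<Sum>k\<in>UNIV. \<Sum>j\<in>UNIV. (cmod (W $ j $ k))\<^sup>2) / CARD('n)
           \<le> partition_sum (uniform_count_measure UNIV) n Y (matrix_op W)"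
proof -
  let ?M = "uniform_count_measure (UNIV :: 'n set)"
  \<comment> \<open>Null sets are empty, so a partition up to null sets is a genuine one, and sums
    over all points split along it.\<close>
  have cover: "(\<Union>i\<in>{1..n}. Y i) = UNIV"
    and disj: "\<forall>i\<in>{1..n}. \<forall>k\<in>{1..n}. i \<noteq> k \<longrightarrow> Y i \<inter> Y k = {}"
    using assms by (auto simp: mu_partition_def measure_uniform_count_measure space_uniform_count_measure)
  define a where "a k = (\<Sum>j\<in>UNIV. (cmod (W $ j $ k))\<^sup>2)" for k
  have "(\<Sum>k\<in>UNIV. a k) = (\<Sum>i=1..n. \<Sum>k\<in>Y i. a k)"
    unfolding cover[symmetric] using disj by (intro sum.UNION_disjoint) auto
  \<comment> \<open>All terms with \<open>k \<in> Y i\<close> have the same bound; counting them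
    yields \<open>card (Y i)\<close>, which is \<open>J\<close> times the measure of
    \<open>Y i\<close>.\<close>
  also have "\<dots> \<le> (\<Sum>i=1..n. card (Y i) * (L2_opnorm ?M (matrix_op W \<circ> proj_op (Y i)))\<^sup>2)"
  proof (intro sum_mono sum_bounded_above)
    fix i k assume "k \<in> Y i"
    then have "(sqrt (a k))\<^sup>2 \<le> (L2_opnorm ?M (matrix_op W \<circ> proj_op (Y i)))\<^sup>2"
      unfolding a_def by (intro power_mono L2_opnorm_matrix_proj_ge) (auto intro: sum_nonneg)
    then show "a k \<le> (L2_opnorm ?M (matrix_op W \<circ> proj_op (Y i)))\<^sup>2"
      by (simp add: a_def sum_nonneg)
  qed
  finally show ?thesis
    by (simp add: partition_sum_def measure_uniform_count_measure a_def divide_right_mono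
        flip: sum_divide_distrib)
qed

lemma partition_sum_matrix_singletons:
  fixes W :: "complex ^ 'n ^ 'n"
  obtains n Y where "mu_partition (uniform_count_measure UNIV) n Y"
    and "partition_sum (uniform_count_measure UNIV) n Y (matrix_op W)
           = (\<Sum>k\<in>UNIV. \<Sum>j\<in>UNIV. (cmod (W $ j $ k))\<^sup>2) / CARD('n)"
proof -
  let ?M = "uniform_count_measure (UNIV :: 'n set)"
  \<comment> \<open>Enumerate from 1, as partitions are indexed by \<open>{1..n}\<close>.
    Surjectivity of \<open>h\<close> gives covering, injectivity gives disjointness.\<close>
  obtain h where h: "bij_betw h {1..CARD('n)} (UNIV :: 'n set)"
    using ex_bij_betw_nat_finite_1[of "UNIV :: 'n set"] by auto
  show thesis
  proof (rule that[of "CARD('n)" "\<lambda>i. {h i}"])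
    show "mu_partition ?M CARD('n) (\<lambda>i. {h i})"
      using h by (auto simp: mu_partition_def measure_uniform_count_measure sets_uniform_count_measure
          space_uniform_count_measure bij_betw_def inj_on_eq_iff)
    have "partition_sum ?M CARD('n) (\<lambda>i. {h i}) (matrix_op W)
        = (\<Sum>i=1..CARD('n). (\<Sum>j\<in>UNIV. (cmod (W $ j $ h i))\<^sup>2) / CARD('n))"
      by (simp add: partition_sum_def measure_uniform_count_measure L2_opnorm_matrix_proj_singleton
          sum_nonneg)
    also have "\<dots> = (\<Sum>k\<in>UNIV. (\<Sum>j\<in>UNIV. (cmod (W $ j $ k))\<^sup>2) / CARD('n))"
      by (rule sum.reindex_bij_betw[OF h])
    finally show "partition_sum ?M CARD('n) (\<lambda>i. {h i}) (matrix_op W)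
        = (\<Sum>k\<in>UNIV. \<Sum>j\<in>UNIV. (cmod (W $ j $ k))\<^sup>2) / CARD('n)"
      by (simp add: sum_divide_distrib)
  qed
qed

lemma mu_norm_matrix_op:
  fixes W :: "complex ^ 'n ^ 'n"
  shows "mu_norm (uniform_count_measure UNIV) (matrix_op W)
           = sqrt ((\<Sum>k\<in>UNIV. \<Sum>j\<in>UNIV. (cmod (W $ j $ k))\<^sup>2) / CARD('n))"
  unfolding mu_norm_def
\<comment> \<open>The infimum is attained, at the partition into singletons.\<close>
proof (rule cInf_eq_minimum)
  obtain n Y where "mu_partition (uniform_count_measure UNIV) n Y"
    and "partition_sum (uniform_count_measure UNIV) n Y (matrix_op W)
           = (\<Sum>k\<in>UNIV. \<Sum>j\<in>UNIV. (cmod (W $ j $ k))\<^sup>2) / CARD('n)"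
    by (rule partition_sum_matrix_singletons)
  then show "sqrt ((\<Sum>k\<in>UNIV. \<Sum>j\<in>UNIV. (cmod (W $ j $ k))\<^sup>2) / CARD('n))
      \<in> {sqrt (partition_sum (uniform_count_measure UNIV) n Y (matrix_op W)) | n Y.
          mu_partition (uniform_count_measure UNIV) n Y}"
    by (metis (mono_tags, lifting) mem_Collect_eq)
next
  fix x assume "x \<in> {sqrt (partition_sum (uniform_count_measure UNIV) n Y (matrix_op W)) | n Y.
          mu_partition (uniform_count_measure UNIV) n Y}"
  then show "sqrt ((\<Sum>k\<in>UNIV. \<Sum>j\<in>UNIV. (cmod (W $ j $ k))\<^sup>2) / CARD('n)) \<le> x"
    using partition_sum_matrix_ge by (auto intro!: real_sqrt_le_mono)
qed

text \<open>Expand \<open>f\<close> in the standard basis: by linearity \<open>U\<close> is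
  determined by the images of the unit vectors, which are the columns of the matrix.\<close>

lemma L2_linear_imp_matrix_op:
  fixes U :: "('n::finite \<Rightarrow> complex) \<Rightarrow> 'n \<Rightarrow> complex"
  assumes "L2_linear (uniform_count_measure UNIV) U"
  shows "U = matrix_op (\<chi> j k. U (\<lambda>i. of_bool (i = k)) j)"
proof
  fix f
  have add: "U (\<lambda>y. g y + h y) x = U g x + U h x" and scale: "U (\<lambda>y. c * g y) x = c * U g x" for g h c x
    using assms by (auto simp: L2_linear_def L2_space_uniform_count AE_uniform_count_iff)
  \<comment> \<open>Additivity is given for two summands only, so the basis expansion is built up by
    induction on the index set.\<close>
  have "U (\<lambda>y. \<Sum>k\<in>A. f k * of_bool (y = k)) x = (\<Sum>k\<in>A. f k * U (\<lambda>i. of_bool (i = k)) x)"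
    if "finite A" for A x
    using that
  proof induction
    case empty
    \<comment> \<open>Homogeneity with factor 0 sends the zero function to zero.\<close>
    show ?case using scale[of 0 "\<lambda>_. 0" x] by simp
  qed (simp add: add scale del: sum_mult_of_bool_eq)
  from this[of UNIV] show "U f = matrix_op (\<chi> j k. U (\<lambda>i. of_bool (i = k)) j) f"
    by (simp add: matrix_op_def fun_eq_iff mult.commute)
qed

lemma matrix_op_comp: "matrix_op A \<circ> matrix_op B = matrix_op (A ** B)"
proof (intro ext, unfold o_apply)
  fix f j
  have "matrix_op A (matrix_op B f) j = (\<Sum>k\<in>UNIV. \<Sum>i\<in>UNIV. A $ j $ k * B $ k $ i * f i)"
    by (simp add: matrix_op_def sum_distrib_left mult.assoc)
  also have "\<dots> = matrix_op (A ** B) f j"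
    by (subst sum.swap) (simp add: matrix_op_def matrix_matrix_mult_def sum_distrib_right)
  finally show "matrix_op A (matrix_op B f) j = matrix_op (A ** B) f j" .
qed

text \<open>The inner products of the images of unit vectors are, up to the factor
  \<open>1 / J\<close>, the entries of \<open>V\<^sup>* V\<close>; preserving them forces
  \<open>V\<^sup>* V = 1\<close>.\<close>

lemma L2_unitary_matrix_op_adjoint:
  fixes V :: "complex ^ 'n ^ 'n"
  assumes "L2_unitary (uniform_count_measure UNIV) (matrix_op V)"
  shows "V ** (\<chi> i j. cnj (V $ j $ i)) = mat 1"
proof -
  have "(\<Sum>i\<in>UNIV. cnj (V $ i $ k) * V $ i $ l) = of_bool (k = l)" for k l
  proof -
    have "L2_inner (uniform_count_measure UNIV) (matrix_op V (\<lambda>i. of_bool (i = l))) (matrix_op V (\<lambda>i. of_bool (i = k)))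
       = L2_inner (uniform_count_measure UNIV) (\<lambda>i. of_bool (i = l)) (\<lambda>i. of_bool (i = k))"
      using assms by (simp add: L2_unitary_def L2_space_uniform_count)
    then show ?thesis
      by (simp add: L2_inner_uniform_count matrix_op_def mult.commute)
  qed
  then have "(\<chi> i j. cnj (V $ j $ i)) ** V = mat 1"
    by (simp add: matrix_matrix_mult_def mat_def vec_eq_iff of_bool_def)
  \<comment> \<open>For square matrices a left inverse is also a right inverse.\<close>
  then show ?thesis
    by (simp add: matrix_left_right_inverse)
qed

lemma frobenius_mult_unitary:
  fixes W V :: "complex ^ 'n ^ 'n"
  assumes "V ** (\<chi> i j. cnj (V $ j $ i)) = mat 1"
  shows "(\<Sum>k\<in>UNIV. \<Sum>j\<in>UNIV. (cmod ((W ** V) $ j $ k))\<^sup>2) = (\<Sum>k\<in>UNIV. \<Sum>j\<in>UNIV. (cmod (W $ j $ k))\<^sup>2)"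
proof -
  define adj :: "complex ^ 'n ^ 'n \<Rightarrow> complex ^ 'n ^ 'n" where "adj A = (\<chi> i j. cnj (A $ j $ i))" for A
  \<comment> \<open>The identity \<open>|z|\<^sup>2 = z * cnj z\<close> lives in the complex
    numbers, hence \<open>of_real\<close>. Swapping the sums puts the row index outside, as in the
    trace.\<close>
  have trace_adj: "of_real (\<Sum>k\<in>UNIV. \<Sum>j\<in>UNIV. (cmod (A $ j $ k))\<^sup>2) = trace (A ** adj A)" for A
    by (subst sum.swap) (simp only: of_real_sum complex_norm_square adj_def trace_def
        matrix_matrix_mult_def vec_lambda_beta)
  have "adj (W ** V) = adj V ** adj W"
    by (simp add: adj_def matrix_matrix_mult_def vec_eq_iff mult.commute)
  moreover have "V ** adj V = mat 1"
    using assms by (simp add: adj_def)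
  ultimately have "(W ** V) ** adj (W ** V) = W ** adj W"
    by (metis matrix_mul_assoc matrix_mul_rid)
  then show ?thesis
    using trace_adj[of W] trace_adj[of "W ** V"] by (metis of_real_eq_iff)
qed

theorem lemma3p3:
  fixes W :: "complex ^ 'n ^ 'n"
    and M :: "'n::finite measure"
  assumes "M = uniform_count_measure UNIV"
  shows "(mu_norm M (matrix_op W))\<^sup>2
           = 1 / real CARD('n) * (\<Sum>j\<in>UNIV. \<Sum>k\<in>UNIV. (cmod (W $ k $ j))\<^sup>2)
         \<and> (\<forall>U. L2_unitary M U \<longrightarrow> mu_norm M (matrix_op W) = mu_norm M (matrix_op W \<circ> U))"
proof (intro conjI allI impI)
  show "(mu_norm M (matrix_op W))\<^sup>2
           = 1 / real CARD('n) * (\<Sum>j\<in>UNIV. \<Sum>k\<in>UNIV. (cmod (W $ k $ j))\<^sup>2)"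
    by (simp add: assms mu_norm_matrix_op sum_nonneg)
next
  fix U assume U: "L2_unitary M U"
  then obtain V where V: "U = matrix_op V"
    using L2_linear_imp_matrix_op assms unfolding L2_unitary_def by blast
  have "V ** (\<chi> i j. cnj (V $ j $ i)) = mat 1"
    using U unfolding V assms by (rule L2_unitary_matrix_op_adjoint)
  then show "mu_norm M (matrix_op W) = mu_norm M (matrix_op W \<circ> U)"
    by (simp add: V assms matrix_op_comp mu_norm_matrix_op frobenius_mult_unitary)
qed

end
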